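(* Let $k_1,k_2,k_3\in\mathbb{Z}_{\ge 0}$ and let $x$ be any cluster variable of the generalized Markov cluster algebra $\mathcal{A}(k_1,k_2,k_3)$. Then there is exactly one index $i\in\{1,2,3\}$ such that $x$ occurs as the $i$-th entry of some labeled cluster; that is, if $x$ is the $i$-th entry of one labeled cluster and the $j$-th entry of another labeled cluster, then $i=j$.
   Context: Let $x_1,x_2,x_3$ be indeterminates. For a triple $(a,b,c)$ of nonzero rational functions in $x_1,x_2,x_3$ define the mutations $\mu_1(a,b,c)=\left(\frac{b^2+k_1bc+c^2}{a},b,c\right)$, $\mu_2(a,b,c)=\left(a,\frac{a^2+k_2ac+c^2}{b},c\right)$, $\mu_3(a,b,c)=\left(a,b,\frac{a^2+k_3ab+b^2}{c}\right)$. A labeled cluster of the (coefficient-free) generalized Markov cluster algebra $\mathcal{A}(k_1,k_2,k_3)$ is any triple obtained from $(x_1,x_2,x_3)$ by a finite sequence of these mutations, and a cluster variable is an entry of a labeled cluster. *)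

theory Defs
  imports "HOL-Computational_Algebra.Computational_Algebra"
begin

text \<open>
  The field of rational functions in three indeterminates over the rationals is rendered as the
  fraction field of the iterated polynomial ring, the innermost variable being \<open>X1\<close>.
\<close>

type_synonym ratfun3 = "rat poly poly poly fract"

definition X1 :: ratfun3 where "X1 = to_fract [:[:[:0, 1:]:]:]"
definition X2 :: ratfun3 where "X2 = to_fract [:[:0, 1:]:]"
definition X3 :: ratfun3 where "X3 = to_fract [:0, 1:]"

type_synonym triple = "ratfun3 \<times> ratfun3 \<times> ratfun3"

text \<open>
  Mutations are meant for triples of nonzero rational functions. The convention \<open>x / 0 = 0\<close> never
  intervenes for labeled clusters: starting from the indeterminates, every entry is a quotient of
  nonzero polynomials with nonnegative coefficients, hence nonzero.
\<close>

fun mut1 :: "nat \<Rightarrow> triple \<Rightarrow> triple" where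
  "mut1 k1 (a, b, c) = ((b^2 + of_nat k1 * b * c + c^2) / a, b, c)"

fun mut2 :: "nat \<Rightarrow> triple \<Rightarrow> triple" where
  "mut2 k2 (a, b, c) = (a, (a^2 + of_nat k2 * a * c + c^2) / b, c)"

fun mut3 :: "nat \<Rightarrow> triple \<Rightarrow> triple" where
  "mut3 k3 (a, b, c) = (a, b, (a^2 + of_nat k3 * a * b + b^2) / c)"

inductive labeled_cluster :: "nat \<Rightarrow> nat \<Rightarrow> nat \<Rightarrow> triple \<Rightarrow> bool" for k1 k2 k3 :: nat where
  initial: "labeled_cluster k1 k2 k3 (X1, X2, X3)"
| mutate1: "labeled_cluster k1 k2 k3 t \<Longrightarrow> labeled_cluster k1 k2 k3 (mut1 k1 t)"
| mutate2: "labeled_cluster k1 k2 k3 t \<Longrightarrow> labeled_cluster k1 k2 k3 (mut2 k2 t)"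
| mutate3: "labeled_cluster k1 k2 k3 t \<Longrightarrow> labeled_cluster k1 k2 k3 (mut3 k3 t)"

text \<open>Only the indices 1, 2, 3 are meaningful; every use below restricts to them.\<close>

fun entry :: "nat \<Rightarrow> triple \<Rightarrow> ratfun3" where
  "entry i (a, b, c) = (if i = 1 then a else if i = 2 then b else c)"

definition cluster_variable :: "nat \<Rightarrow> nat \<Rightarrow> nat \<Rightarrow> ratfun3 \<Rightarrow> bool" where
  "cluster_variable k1 k2 k3 x \<longleftrightarrow>
     (\<exists>t. labeled_cluster k1 k2 k3 t \<and> (\<exists>i\<in>{1, 2, 3}. entry i t = x))"

end

theory Submission
  imports Defs
begin

text \<open>
  The field of rational functions is linearly ordered, with \<open>X3\<close> infinitely larger than every
  power of \<open>X2\<close>, and \<open>X2\<close> infinitely larger than every power of \<open>X1\<close>. All cluster variables are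
  positive. Up to bounded integer factors, \<open>b\<^sup>2 + k b c + c\<^sup>2\<close> is the square of \<open>max b c\<close>, so a
  mutation does not change the class of an entry modulo squares and bounded factors: the
  \<open>i\<close>-th entry is always comparable to the \<open>i\<close>-th indeterminate times a square. Distinct
  indeterminates lie in distinct classes because comparable polynomials have the same leading
  exponents, and the parities of these exponents survive multiplication by squares.
\<close>

section \<open>Archimedean equivalence of positive elements\<close>

definition comparable :: "'a::linordered_idom \<Rightarrow> 'a \<Rightarrow> bool" where
  "comparable a b \<longleftrightarrow> 0 < a \<and> 0 < b \<and> (\<exists>n::nat. a \<le> of_nat n * b \<and> b \<le> of_nat n * a)"

lemma comparable_pos:
  assumes "comparable a b"
  shows "0 < a" and "0 < b"
  using assms by (auto simp: comparable_def)

lemma comparable_refl: "0 < a \<Longrightarrow> comparable a a"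
  unfolding comparable_def by (auto intro!: exI[of _ 1])

lemma comparable_sym: "comparable a b \<Longrightarrow> comparable b a"
  by (auto simp: comparable_def)

lemma comparable_trans:
  assumes "comparable a b" "comparable b c"
  shows "comparable a c"
proof -
  obtain m n :: nat where m: "a \<le> of_nat m * b" "b \<le> of_nat m * a"
    and n: "b \<le> of_nat n * c" "c \<le> of_nat n * b"
    using assms by (auto simp: comparable_def)
  have "a \<le> of_nat m * (of_nat n * c)"
    using m(1) mult_left_mono[OF n(1)] by (meson of_nat_0_le_iff order_trans)
  moreover have "c \<le> of_nat n * (of_nat m * a)"
    using n(2) mult_left_mono[OF m(2)] by (meson of_nat_0_le_iff order_trans)
  ultimately show ?thesis
    using assms unfolding comparable_def
    by (auto intro!: exI[of _ "m * n"] simp: mult_ac)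
qed

lemma comparable_mult:
  assumes "comparable a b" "comparable c d"
  shows "comparable (a * c) (b * d)"
proof -
  obtain m n :: nat where m: "a \<le> of_nat m * b" "b \<le> of_nat m * a"
    and n: "c \<le> of_nat n * d" "d \<le> of_nat n * c"
    using assms by (auto simp: comparable_def)
  note pos = comparable_pos[OF assms(1)] comparable_pos[OF assms(2)]
  have "a * c \<le> (of_nat m * b) * (of_nat n * d)"
    using m n pos by (intro mult_mono) auto
  moreover have "b * d \<le> (of_nat m * a) * (of_nat n * c)"
    using m n pos by (intro mult_mono) auto
  ultimately show ?thesis
    using pos unfolding comparable_def
    by (auto intro!: exI[of _ "m * n"] simp: mult_ac)
qed

lemma comparable_inverse:
  fixes a b :: "'a::linordered_field"
  assumes "comparable a b"
  shows "comparable (inverse a) (inverse b)"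
  using assms by (auto simp: comparable_def field_simps)

text \<open>The embedding \<open>to_fract\<close> preserves and reflects the order and fixes the
  natural numbers, so a comparison whose denominators are cleared can be read in the domain.\<close>

lemma comparable_to_fract_iff: "comparable (to_fract p) (to_fract q) \<longleftrightarrow> comparable p q"
proof -
  have of_nat: "of_nat n = to_fract (of_nat n :: 'a)" for n
    by (induction n) simp_all
  have le: "to_fract p \<le> to_fract q \<longleftrightarrow> p \<le> q" for p q :: 'a
    by (simp add: to_fract_def)
  have pos: "0 < to_fract p \<longleftrightarrow> 0 < p" for p :: 'a
    by (simp add: to_fract_def zero_less_Fract_iff)
  show ?thesis
    unfolding comparable_def of_nat by (simp add: le pos flip: to_fract_mult)
qed

section \<open>Leading terms of comparable polynomials\<close>

lemma lead_coeff_pos_iff: "0 < lead_coeff p \<longleftrightarrow> 0 < p"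
  by (simp add: less_poly_def pos_poly_def)

text \<open>Otherwise the leading coefficient of \<open>q - p\<close> would be that of
  \<open>- p\<close>, which is negative.\<close>

lemma poly_le_imp_degree_le:
  fixes p q :: "'a::linordered_idom poly"
  assumes "0 < p" "p \<le> q"
  shows "degree p \<le> degree q"
proof (rule ccontr)
  assume *: "\<not> degree p \<le> degree q"
  then have "lead_coeff (q - p) = - lead_coeff p"
    by (metis coeff_diff coeff_eq_0 degree_minus diff_0 degree_add_eq_right not_le diff_conv_add_uminus)
  moreover have "0 < q - p"
    using * assms by (auto simp: order_less_le)
  ultimately show False
    using assms(1) lead_coeff_pos_iff[of p] lead_coeff_pos_iff[of "q - p"] by simp
qed

lemma poly_le_imp_lead_coeff_le:
  fixes p q :: "'a::linordered_idom poly"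
  assumes "p \<le> q" "degree p = degree q"
  shows "lead_coeff p \<le> lead_coeff q"
proof (rule ccontr)
  assume *: "\<not> lead_coeff p \<le> lead_coeff q"
  then have pos: "coeff (p - q) (degree p) > 0"
    using assms(2) by simp
  have "degree (p - q) \<le> degree p"
    using assms(2) by (intro degree_diff_le) simp_all
  moreover have "degree p \<le> degree (p - q)"
    using pos by (intro le_degree) (rule less_imp_neq[symmetric])
  ultimately have "0 < p - q"
    using pos by (metis antisym lead_coeff_pos_iff)
  then show False
    using assms(1) by simp
qed

text \<open>A nonzero integer factor keeps the degree, so the two bounds force equal degrees and
  then pass to the leading coefficients. Repeated use peels off one variable at a time.\<close>

lemma comparable_poly:
  assumes "comparable p q"
  shows "degree p = degree q" and "comparable (lead_coeff p) (lead_coeff q)"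
proof -
  obtain n :: nat where n: "p \<le> of_nat n * q" "q \<le> of_nat n * p"
    using assms by (auto simp: comparable_def)
  note pos = comparable_pos[OF assms]
  have "n \<noteq> 0"
    using n(1) pos(1) by (intro notI) simp
  then have deg: "degree (of_nat n * r) = degree r" for r :: "'a poly"
    by (cases "r = 0") (simp_all add: degree_mult_eq)
  have lc: "lead_coeff (of_nat n * r) = of_nat n * lead_coeff r" for r :: "'a poly"
    by (simp only: lead_coeff_mult lead_coeff_of_nat)
  show eq: "degree p = degree q"
    using poly_le_imp_degree_le[OF pos(1) n(1)] poly_le_imp_degree_le[OF pos(2) n(2)]
    by (simp only: deg antisym)
  have "lead_coeff p \<le> lead_coeff (of_nat n * q)"
    by (rule poly_le_imp_lead_coeff_le[OF n(1)]) (simp only: deg eq)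
  moreover have "lead_coeff q \<le> lead_coeff (of_nat n * p)"
    by (rule poly_le_imp_lead_coeff_le[OF n(2)]) (simp only: deg eq)
  ultimately show "comparable (lead_coeff p) (lead_coeff q)"
    unfolding comparable_def lc using pos by (auto simp: lead_coeff_pos_iff)
qed

section \<open>Classes modulo squares and mutation\<close>

text \<open>One square factor, on the right, is enough because squares are invertible in a
  field.\<close>

definition square_equiv :: "'a::linordered_field \<Rightarrow> 'a \<Rightarrow> bool" where
  "square_equiv x y \<longleftrightarrow> (\<exists>s>0. comparable x (y * s\<^sup>2))"

lemma square_equiv_refl: "0 < x \<Longrightarrow> square_equiv x x"
  unfolding square_equiv_def by (intro exI[of _ 1]) (simp add: comparable_refl)

lemma square_equiv_pos: "square_equiv x y \<Longrightarrow> 0 < x"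
  by (auto simp: square_equiv_def dest: comparable_pos)

text \<open>With \<open>m = max b c\<close>, the sum has nonnegative terms, one of which is
  \<open>m^2\<close>, and is at most \<open>(k + 2) * m^2\<close>.\<close>

lemma comparable_max_square:
  fixes b c :: "'a::linordered_idom"
  assumes "0 < b" "0 < c"
  shows "comparable (b\<^sup>2 + of_nat k * b * c + c\<^sup>2) ((max b c)\<^sup>2)"
proof -
  let ?m = "max b c" and ?r = "b\<^sup>2 + of_nat k * b * c + c\<^sup>2"
  have b: "b\<^sup>2 \<le> ?m\<^sup>2" and c: "c\<^sup>2 \<le> ?m\<^sup>2"
    using assms by (auto intro!: power_mono)
  have "b * c \<le> ?m\<^sup>2"
    unfolding power2_eq_square using assms by (intro mult_mono) auto
  then have "of_nat k * b * c \<le> of_nat k * ?m\<^sup>2"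
    by (simp add: mult.assoc mult_left_mono)
  with b c have "?r \<le> of_nat (k + 2) * ?m\<^sup>2"
    by (simp add: algebra_simps)
  moreover have k: "0 \<le> of_nat k * b * c"
    using assms by simp
  have "?m\<^sup>2 \<le> ?r"
    using k by (simp add: max_def)
  moreover from this have pos: "0 < ?r" "0 < ?m\<^sup>2"
    using assms k by (simp_all add: add_pos_pos add_pos_nonneg max_def)
  \<comment> \<open>\<open>comparable\<close> asks for one factor in both directions, so the lower
    bound is weakened to \<open>k + 2\<close>.\<close>
  moreover have "?r \<le> of_nat (k + 2) * ?r"
    using pos mult_right_mono[of 1 "of_nat (k + 2)" ?r] by simp
  ultimately show ?thesis
    unfolding comparable_def by (meson order_trans)
qed

lemma square_equiv_mutation:
  assumes "square_equiv a x" "0 < b" "0 < c"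
  shows "square_equiv ((b\<^sup>2 + of_nat k * b * c + c\<^sup>2) / a) x"
proof -
  obtain s where s: "s > 0" "comparable a (x * s\<^sup>2)"
    using assms(1) by (auto simp: square_equiv_def)
  then have x: "0 < x"
    using comparable_pos(2)[OF s(2)] by (simp add: zero_less_mult_iff)
  \<comment> \<open>The new entry is comparable to \<open>m^2 / (x * s^2)\<close> with
    \<open>m = max b c\<close>, and this equals \<open>x * (m / (x * s))^2\<close>.\<close>
  let ?t = "max b c / (x * s)"
  have "comparable ((b\<^sup>2 + of_nat k * b * c + c\<^sup>2) * inverse a)
      ((max b c)\<^sup>2 * inverse (x * s\<^sup>2))"
    by (intro comparable_mult comparable_max_square comparable_inverse assms s)
  also have "(max b c)\<^sup>2 * inverse (x * s\<^sup>2) = x * ?t\<^sup>2"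
    using x s by (simp add: field_simps power2_eq_square)
  finally have "comparable ((b\<^sup>2 + of_nat k * b * c + c\<^sup>2) / a) (x * ?t\<^sup>2)"
    by (simp add: divide_inverse)
  moreover have "?t > 0"
    using x s assms by (simp add: less_max_iff_disj)
  ultimately show ?thesis
    unfolding square_equiv_def by blast
qed

section \<open>Clearing denominators and parity of degrees\<close>

lemma pos_fract_cases:
  fixes s :: "'a::linordered_idom fract"
  assumes "0 < s"
  obtains p q where "0 < p" "0 < q" "s = to_fract p / to_fract q"
proof (cases s)
  case (Fract p q)
  show ?thesis
  proof (cases "0 < q")
    case True
    moreover from this have "0 < p"
      using Fract(1) assms by (simp only: zero_less_Fract_iff)
    ultimately show ?thesis
      using that Fract(1) by (simp add: Fract_conv_to_fract)
  next
    case False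
    then have "0 < - q" "s = Fract (- p) (- q)"
      using Fract by (simp_all add: eq_fract)
    moreover from this have "0 < - p"
      using assms by (simp only: zero_less_Fract_iff)
    ultimately show ?thesis
      using that[of "- p" "- q"] by (simp only: Fract_conv_to_fract)
  qed
qed

lemma square_equiv_common:
  fixes f g :: "'a::linordered_idom"
  assumes "square_equiv x (to_fract f)" "square_equiv x (to_fract g)"
  obtains p q where "0 < p" "0 < q" "comparable (f * p\<^sup>2) (g * q\<^sup>2)"
proof -
  obtain s t where s: "0 < s" "comparable x (to_fract f * s\<^sup>2)"
    and t: "0 < t" "comparable x (to_fract g * t\<^sup>2)"
    using assms by (auto simp: square_equiv_def)
  obtain a b where ab: "0 < a" "0 < b" "s = to_fract a / to_fract b"
    using pos_fract_cases[OF s(1)] .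
  obtain c d where cd: "0 < c" "0 < d" "t = to_fract c / to_fract d"
    using pos_fract_cases[OF t(1)] .
  \<comment> \<open>\<open>b * d\<close> is a common denominator of \<open>s\<close> and
    \<open>t\<close>; multiplying by its square clears denominators and leaves squares.\<close>
  let ?m = "(to_fract (b * d))\<^sup>2"
  have "?m > 0"
    using ab cd by simp
  then have "comparable (to_fract f * s\<^sup>2 * ?m) (to_fract g * t\<^sup>2 * ?m)"
    by (intro comparable_mult comparable_refl comparable_trans[OF comparable_sym[OF s(2)] t(2)])
  moreover have "to_fract f * s\<^sup>2 * ?m = to_fract (f * (a * d)\<^sup>2)"
    using ab cd by (simp add: power2_eq_square)
  moreover have "to_fract g * t\<^sup>2 * ?m = to_fract (g * (c * b)\<^sup>2)"
    using ab cd by (simp add: power2_eq_square)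
  ultimately have "comparable (f * (a * d)\<^sup>2) (g * (c * b)\<^sup>2)"
    by (simp only: comparable_to_fract_iff)
  then show ?thesis
    using that[of "a * d" "c * b"] ab cd by simp
qed

lemma square_equiv_parity:
  fixes f g :: "'a::linordered_idom poly poly"
  assumes "square_equiv x (to_fract f)" "square_equiv x (to_fract g)"
  shows "even (degree f) \<longleftrightarrow> even (degree g)"
    and "even (degree (lead_coeff f)) \<longleftrightarrow> even (degree (lead_coeff g))"
proof -
  obtain p q where pq: "0 < p" "0 < q" "comparable (f * p\<^sup>2) (g * q\<^sup>2)"
    using square_equiv_common[OF assms] .
  have "0 < f" "0 < g"
    using pq comparable_pos[OF pq(3)] by (simp_all add: zero_less_mult_iff)
  with pq have nz: "f \<noteq> 0" "g \<noteq> 0" "p \<noteq> 0" "q \<noteq> 0"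
    by auto
  have "degree f + 2 * degree p = degree g + 2 * degree q"
    using comparable_poly(1)[OF pq(3)] nz by (simp add: degree_mult_eq degree_power_eq)
  then show "even (degree f) \<longleftrightarrow> even (degree g)"
    by presburger
  \<comment> \<open>Leading coefficients are multiplicative, so the same degree count works one
    variable further in.\<close>
  have "comparable (lead_coeff f * (lead_coeff p)\<^sup>2) (lead_coeff g * (lead_coeff q)\<^sup>2)"
    using comparable_poly(2)[OF pq(3)] by (simp only: lead_coeff_mult lead_coeff_power)
  then have "degree (lead_coeff f) + 2 * degree (lead_coeff p)
      = degree (lead_coeff g) + 2 * degree (lead_coeff q)"
    using comparable_poly(1) nz by (fastforce simp: degree_mult_eq degree_power_eq)
  then show "even (degree (lead_coeff f)) \<longleftrightarrow> even (degree (lead_coeff g))"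
    by presburger
qed

section \<open>Labeled clusters\<close>

lemma indeterminates_pos: "0 < X1" "0 < X2" "0 < X3"
  by (simp_all add: X1_def X2_def X3_def to_fract_def zero_less_Fract_iff flip: lead_coeff_pos_iff)

text \<open>The invariant carries its own positivity: \<open>square_equiv_pos\<close> supplies what
  a mutation needs of the two entries it keeps.\<close>

lemma labeled_cluster_square_equiv:
  assumes "labeled_cluster k1 k2 k3 t"
  shows "square_equiv (entry 1 t) X1 \<and> square_equiv (entry 2 t) X2 \<and> square_equiv (entry 3 t) X3"
  using assms
proof induction
  case initial
  then show ?case
    by (simp add: square_equiv_refl indeterminates_pos)
next
  case (mutate1 t)
  then show ?case
    by (cases t) (auto intro!: square_equiv_mutation intro: square_equiv_pos)
next
  case (mutate2 t)
  then show ?case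
    by (cases t) (auto intro!: square_equiv_mutation intro: square_equiv_pos)
next
  case (mutate3 t)
  then show ?case
    by (cases t) (auto intro!: square_equiv_mutation intro: square_equiv_pos)
qed

text \<open>The degree in the outermost variable and the degree of the leading coefficient are (0,
  0) for \<open>X1\<close>, (0, 1) for \<open>X2\<close> and (1, 0) for \<open>X3\<close>, so any
  two differ in some parity.\<close>

lemma square_equiv_indeterminate_unique:
  shows "square_equiv x X1 \<Longrightarrow> \<not> square_equiv x X2"
    and "square_equiv x X1 \<Longrightarrow> \<not> square_equiv x X3"
    and "square_equiv x X2 \<Longrightarrow> \<not> square_equiv x X3"
  unfolding X1_def X2_def X3_def
  by (auto dest: square_equiv_parity(2))
     (auto dest: square_equiv_parity(1))

theorem theorem3p3:
  fixes k1 k2 k3 :: nat and x :: ratfun3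
  assumes "cluster_variable k1 k2 k3 x"
  shows "\<exists>!i. i \<in> {1, 2, 3} \<and> (\<exists>t. labeled_cluster k1 k2 k3 t \<and> entry i t = x)"
proof (rule ex_ex1I)
  show "\<exists>i. i \<in> {1, 2, 3} \<and> (\<exists>t. labeled_cluster k1 k2 k3 t \<and> entry i t = x)"
    using assms unfolding cluster_variable_def by blast
next
  fix i j
  \<comment> \<open>The initial cluster serves as a table of the indeterminates, so the three
    indices are treated uniformly.\<close>
  let ?X = "\<lambda>i. entry i (X1, X2, X3)"
  assume i: "i \<in> {1, 2, 3} \<and> (\<exists>t. labeled_cluster k1 k2 k3 t \<and> entry i t = x)"
    and j: "j \<in> {1, 2, 3} \<and> (\<exists>t. labeled_cluster k1 k2 k3 t \<and> entry j t = x)"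
  have "square_equiv x (?X i)" "square_equiv x (?X j)"
    using i j by (auto dest!: labeled_cluster_square_equiv)
  then show "i = j"
    using i j square_equiv_indeterminate_unique[of x] by auto
qed

end
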